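(* Let $c \geq 1$ be a real number and let $G$ be a (possibly infinite) graph whose growth satisfies $f_G(r) \leq cr$ for every positive integer $r$. Then $\operatorname{tw}(G) \leq 49c^2 + 30c$.
   Context: Graphs are undirected and may be infinite. The growth of a graph $G$ is the function $f_G\colon \mathbb{N}\to\mathbb{N}\cup\{\infty\}$ (with $\mathbb{N}$ the positive integers) where $f_G(r)$ is the supremum of $|V(H)|$ over all subgraphs $H$ of $G$ of radius at most $r$. A tree-decomposition of $G$ is a family $(B_x \subseteq V(G) : x\in V(T))$ indexed by the nodes of a tree $T$ such that every edge of $G$ has both ends in some bag $B_x$, and for every vertex $v$ the set $\{x : v\in B_x\}$ induces a non-empty subtree of $T$. Its width is the maximum bag size minus $1$. The treewidth $\operatorname{tw}(G)$ is the minimum width of a tree-decomposition of $G$, or $\infty$ if no tree-decomposition of finite width exists. *)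

theory Defs
  imports Main "HOL-Library.Extended_Nat"
begin

definition is_graph :: "'a set \<Rightarrow> ('a \<Rightarrow> 'a \<Rightarrow> bool) \<Rightarrow> bool" where
  "is_graph V E \<longleftrightarrow> (\<forall>u v. E u v \<longrightarrow> u \<in> V \<and> v \<in> V \<and> E v u \<and> u \<noteq> v)"

definition walk :: "('a \<Rightarrow> 'a \<Rightarrow> bool) \<Rightarrow> 'a list \<Rightarrow> bool" where
  "walk E xs \<longleftrightarrow> (\<forall>i. Suc i < length xs \<longrightarrow> E (xs ! i) (xs ! Suc i))"

definition connected_in :: "('a \<Rightarrow> 'a \<Rightarrow> bool) \<Rightarrow> 'a set \<Rightarrow> bool" where
  "connected_in E S \<longleftrightarrow> (\<forall>x\<in>S. \<forall>y\<in>S. \<exists>p. p \<noteq> [] \<and> hd p = x \<and> last p = y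
      \<and> set p \<subseteq> S \<and> walk E p)"

definition is_tree :: "'b set \<Rightarrow> ('b \<Rightarrow> 'b \<Rightarrow> bool) \<Rightarrow> bool" where
  "is_tree TV TE \<longleftrightarrow> is_graph TV TE \<and> TV \<noteq> {} \<and>
     (\<forall>x\<in>TV. \<forall>y\<in>TV. \<exists>!p. p \<noteq> [] \<and> hd p = x \<and> last p = y \<and> distinct p \<and> walk TE p)"

definition subgraph :: "'a set \<Rightarrow> ('a \<Rightarrow> 'a \<Rightarrow> bool) \<Rightarrow> 'a set \<Rightarrow> ('a \<Rightarrow> 'a \<Rightarrow> bool) \<Rightarrow> bool" where
  "subgraph V' E' V E \<longleftrightarrow> is_graph V' E' \<and> V' \<subseteq> V \<and> (\<forall>u v. E' u v \<longrightarrow> E u v)"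

definition radius_le :: "'a set \<Rightarrow> ('a \<Rightarrow> 'a \<Rightarrow> bool) \<Rightarrow> nat \<Rightarrow> bool" where
  "radius_le V E r \<longleftrightarrow> (\<exists>v\<in>V. \<forall>u\<in>V. \<exists>p. p \<noteq> [] \<and> hd p = v \<and> last p = u
      \<and> set p \<subseteq> V \<and> walk E p \<and> length p \<le> r + 1)"

definition ecard :: "'a set \<Rightarrow> enat" where
  "ecard S = (if finite S then enat (card S) else \<infinity>)"

definition growth :: "'a set \<Rightarrow> ('a \<Rightarrow> 'a \<Rightarrow> bool) \<Rightarrow> nat \<Rightarrow> enat" where
  "growth V E r = (SUP H \<in> {(V', E'). subgraph V' E' V E \<and> radius_le V' E' r}. ecard (fst H))"

definition tree_decomposition ::
  "'a set \<Rightarrow> ('a \<Rightarrow> 'a \<Rightarrow> bool) \<Rightarrow> 'b set \<Rightarrow> ('b \<Rightarrow> 'b \<Rightarrow> bool) \<Rightarrow> ('b \<Rightarrow> 'a set) \<Rightarrow> bool" where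
  "tree_decomposition V E TV TE B \<longleftrightarrow> is_tree TV TE \<and>
     (\<forall>x\<in>TV. B x \<subseteq> V) \<and>
     (\<forall>u v. E u v \<longrightarrow> (\<exists>x\<in>TV. u \<in> B x \<and> v \<in> B x)) \<and>
     (\<forall>v\<in>V. {x\<in>TV. v \<in> B x} \<noteq> {} \<and> connected_in TE {x\<in>TV. v \<in> B x})"

definition width_le :: "'b set \<Rightarrow> ('b \<Rightarrow> 'a set) \<Rightarrow> nat \<Rightarrow> bool" where
  "width_le TV B k \<longleftrightarrow> (\<forall>x\<in>TV. finite (B x) \<and> card (B x) \<le> k + 1)"

text \<open>Treewidth (as an extended natural, \<infinity> if no finite-width decomposition exists).
Tree nodes are taken from the type 'a set, which is large enough to index a tree of
any needed cardinality.\<close>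
definition treewidth :: "'a set \<Rightarrow> ('a \<Rightarrow> 'a \<Rightarrow> bool) \<Rightarrow> enat" where
  "treewidth V E = Inf {enat k | k. \<exists>(TV :: 'a set set) TE B.
      tree_decomposition V E TV TE B \<and> width_le TV B k}"

end

theory Submission
  imports Defs
begin

text \<open>Linear growth makes every ball of radius \<open>R\<close> coverable by \<open>O(c)\<close> balls of about half that
  radius, each bounded by a sphere of size \<open>O(c)\<close> (by averaging over the radius). For a finite set
  \<open>W\<close>, call a connected set big if it contains more than half of \<open>W\<close>. Applying the covering to a
  ball of minimal radius containing a big connected set shows that the union of \<open>O(c)\<close> such
  spheres, a set of at most \<open>10 c\<^sup>2\<close> vertices, leaves no big connected set: \<open>W\<close> has a balanced
  separator. Splitting recursively along balanced separators of \<open>W = N(D) \<union> {v}\<close> gives a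
  tree-decomposition whose nodes are the vertex sets \<open>D\<close> that occur. This also works for infinite
  graphs, because \<open>v\<close> is chosen in \<open>D\<close> at minimal distance from a root of its component, so that
  every vertex enters a bag after finitely many steps.\<close>

section \<open>Walks and connected sets\<close>

lemma walk_eq_successively: "walk E p = successively E p"
  by (simp add: walk_def successively_conv_nth)

text \<open>The edge relation of the induced subgraph on \<open>S\<close>. Its reflexive transitive
  closure replaces walks inside \<open>S\<close>, so connectedness is handled by closure
  induction.\<close>

definition restr :: "('a \<Rightarrow> 'a \<Rightarrow> bool) \<Rightarrow> 'a set \<Rightarrow> 'a \<Rightarrow> 'a \<Rightarrow> bool" where
  "restr E S a b \<longleftrightarrow> a \<in> S \<and> b \<in> S \<and> E a b"

lemma walk_imp_rtranclp:
  assumes "p \<noteq> []" "walk E p" "set p \<subseteq> S"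
  shows "(restr E S)\<^sup>*\<^sup>* (hd p) (last p)"
  using assms
proof (induction p rule: list_nonempty_induct)
  case (cons x xs)
  then have "(restr E S)\<^sup>*\<^sup>* (hd xs) (last xs)"
    by (auto simp: walk_eq_successively successively_Cons)
  moreover have "restr E S x (hd xs)"
    using cons by (auto simp: restr_def walk_eq_successively successively_Cons)
  ultimately show ?case
    using cons.hyps by (simp add: converse_rtranclp_into_rtranclp)
qed auto

lemma rtranclp_imp_walk:
  assumes "(restr E S)\<^sup>*\<^sup>* x y" "x \<in> S"
  shows "\<exists>p. p \<noteq> [] \<and> hd p = x \<and> last p = y \<and> set p \<subseteq> S \<and> walk E p"
  using assms
proof (induction rule: rtranclp_induct)
  case base
  then show ?case
    by (intro exI[of _ "[x]"]) (auto simp: walk_eq_successively)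
next
  case (step y z)
  then obtain p where "p \<noteq> []" "hd p = x" "last p = y" "set p \<subseteq> S" "walk E p"
    by auto
  with step.hyps show ?case
    by (intro exI[of _ "p @ [z]"])
      (auto simp: walk_eq_successively successively_append_iff restr_def)
qed

lemma connected_in_iff:
  "connected_in E S \<longleftrightarrow> (\<forall>x\<in>S. \<forall>y\<in>S. (restr E S)\<^sup>*\<^sup>* x y)"
  unfolding connected_in_def
  by (metis rtranclp_imp_walk walk_imp_rtranclp)

lemma restr_mono: "(restr E S)\<^sup>*\<^sup>* x y \<Longrightarrow> S \<subseteq> T \<Longrightarrow> (restr E T)\<^sup>*\<^sup>* x y"
  by (erule rtranclp_mono[THEN predicate2D, rotated]) (auto simp: restr_def)

lemma restr_sym:
  assumes "\<And>u v. E u v \<Longrightarrow> E v u" "(restr E S)\<^sup>*\<^sup>* x y"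
  shows "(restr E S)\<^sup>*\<^sup>* y x"
  using assms(2)
proof (induction rule: rtranclp_induct)
  case (step y z)
  then have "restr E S z y"
    using assms(1) by (simp add: restr_def)
  with step.IH show ?case
    by (simp add: converse_rtranclp_into_rtranclp)
qed simp

lemma connected_in_subset_closed:
  assumes "connected_in E C" "x \<in> C" "x \<in> A"
    and "\<And>a b. a \<in> C \<Longrightarrow> b \<in> C \<Longrightarrow> E a b \<Longrightarrow> a \<in> A \<Longrightarrow> b \<in> A"
  shows "C \<subseteq> A"
proof
  fix y assume "y \<in> C"
  then have "(restr E C)\<^sup>*\<^sup>* x y"
    using assms by (auto simp: connected_in_iff)
  then show "y \<in> A"
    using assms(3,4) by (induction rule: rtranclp_induct) (auto simp: restr_def)
qed


section \<open>Boundaries and components\<close>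

text \<open>The open neighbourhood N(D), taken outside \<open>D\<close>.\<close>

definition bd :: "('a \<Rightarrow> 'a \<Rightarrow> bool) \<Rightarrow> 'a set \<Rightarrow> 'a set" where
  "bd E D = {w. w \<notin> D \<and> (\<exists>u\<in>D. E u w)}"

definition comps :: "('a \<Rightarrow> 'a \<Rightarrow> bool) \<Rightarrow> 'a set \<Rightarrow> 'a set set" where
  "comps E S = (\<lambda>x. {y. (restr E S)\<^sup>*\<^sup>* x y}) ` S"

lemma comps_subset: "C \<in> comps E S \<Longrightarrow> C \<subseteq> S"
proof -
  have "y \<in> S" if "(restr E S)\<^sup>*\<^sup>* x y" "x \<in> S" for x y
    using that by cases (simp_all add: restr_def)
  then show "C \<in> comps E S \<Longrightarrow> C \<subseteq> S"
    by (auto simp: comps_def)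
qed

lemma comps_nonempty: "C \<in> comps E S \<Longrightarrow> C \<noteq> {}"
  by (auto simp: comps_def)

lemma comps_cover: "x \<in> S \<Longrightarrow> \<exists>C\<in>comps E S. x \<in> C"
  by (auto simp: comps_def)

lemma comps_bd: "C \<in> comps E S \<Longrightarrow> bd E C \<inter> S = {}"
proof (rule ccontr)
  assume C: "C \<in> comps E S" and "bd E C \<inter> S \<noteq> {}"
  then obtain u w where uw: "u \<in> C" "E u w" "w \<in> S" "w \<notin> C"
    by (auto simp: bd_def)
  with C comps_subset[OF C] obtain x where "(restr E S)\<^sup>*\<^sup>* x u" "C = {y. (restr E S)\<^sup>*\<^sup>* x y}"
    "restr E S u w"
    by (auto simp: comps_def restr_def)
  with uw show False
    by (auto dest: rtranclp.rtrancl_into_rtrancl)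
qed

context
  fixes E :: "'a \<Rightarrow> 'a \<Rightarrow> bool"
  assumes E_sym: "\<And>u v. E u v \<Longrightarrow> E v u"
begin

lemma comps_unique:
  assumes "C \<in> comps E S" "C' \<in> comps E S" "v \<in> C" "v \<in> C'"
  shows "C = C'"
proof -
  from assms obtain x x' where x: "C = {y. (restr E S)\<^sup>*\<^sup>* x y}" "C' = {y. (restr E S)\<^sup>*\<^sup>* x' y}"
    by (auto simp: comps_def)
  with assms have "(restr E S)\<^sup>*\<^sup>* x v" "(restr E S)\<^sup>*\<^sup>* x' v"
    by auto
  then have "(restr E S)\<^sup>*\<^sup>* v x" "(restr E S)\<^sup>*\<^sup>* v x'"
    by (auto intro: restr_sym[of E, OF E_sym])
  then have "(restr E S)\<^sup>*\<^sup>* x x'" "(restr E S)\<^sup>*\<^sup>* x' x"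
    using \<open>(restr E S)\<^sup>*\<^sup>* x v\<close> \<open>(restr E S)\<^sup>*\<^sup>* x' v\<close> rtranclp_trans by metis+
  then have "(restr E S)\<^sup>*\<^sup>* x y \<longleftrightarrow> (restr E S)\<^sup>*\<^sup>* x' y" for y
    using rtranclp_trans by metis
  with x show ?thesis
    by simp
qed

lemma comps_connected:
  assumes "C \<in> comps E S"
  shows "connected_in E C"
proof -
  from assms obtain x where x: "C = {y. (restr E S)\<^sup>*\<^sup>* x y}"
    by (auto simp: comps_def)
  have from_x: "(restr E C)\<^sup>*\<^sup>* x y" if "(restr E S)\<^sup>*\<^sup>* x y" for y
    using that
  proof (induction rule: rtranclp_induct)
    case (step y z)
    have "(restr E S)\<^sup>*\<^sup>* x z"
      using step.hyps by (rule rtranclp.rtrancl_into_rtrancl)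
    with step.hyps x have "y \<in> C" "z \<in> C" "E y z"
      by (simp_all add: restr_def[of E S y z])
    then have "restr E C y z"
      by (simp add: restr_def)
    with step.IH show ?case
      by auto
  qed auto
  show ?thesis
    unfolding connected_in_iff
  proof (intro ballI)
    fix y z assume "y \<in> C" "z \<in> C"
    then have "(restr E C)\<^sup>*\<^sup>* y x" "(restr E C)\<^sup>*\<^sup>* x z"
      using x from_x by (simp_all add: restr_sym[of E, OF E_sym])
    then show "(restr E C)\<^sup>*\<^sup>* y z"
      by (rule rtranclp_trans)
  qed
qed

end


section \<open>Trees from a parent relation\<close>

text \<open>Rooted form of a tree: levels and unique parents are what the recursive construction
  provides, unique simple paths are what \<open>is_tree\<close> demands.\<close>

locale parent_tree =
  fixes TV :: "'b set" and P :: "'b \<Rightarrow> 'b \<Rightarrow> bool" and d :: "'b \<Rightarrow> nat"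
  assumes P_in: "P x y \<Longrightarrow> x \<in> TV \<and> y \<in> TV"
    and P_depth: "P x y \<Longrightarrow> d y = Suc (d x)"
    and P_unique: "P x y \<Longrightarrow> P x' y \<Longrightarrow> x = x'"
    and P_ex: "y \<in> TV \<Longrightarrow> d y > 0 \<Longrightarrow> \<exists>x. P x y"
    and root_unique: "x \<in> TV \<Longrightarrow> y \<in> TV \<Longrightarrow> d x = 0 \<Longrightarrow> d y = 0 \<Longrightarrow> x = y"
    and nonempty: "TV \<noteq> {}"
begin

definition TE :: "'b \<Rightarrow> 'b \<Rightarrow> bool" where
  "TE x y \<longleftrightarrow> P x y \<or> P y x"

lemma TE_sym: "TE x y \<Longrightarrow> TE y x"
  by (auto simp: TE_def)

definition tree_path :: "'b \<Rightarrow> 'b \<Rightarrow> 'b list \<Rightarrow> bool" where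
  "tree_path x y p \<longleftrightarrow> p \<noteq> [] \<and> hd p = x \<and> last p = y \<and> distinct p \<and> successively TE p"

lemma tree_path_rev: "tree_path x y p \<Longrightarrow> tree_path y x (rev p)"
  unfolding tree_path_def
  by (auto simp: hd_rev last_rev TE_def disj_commute intro: successively_mono)

text \<open>Once a repetition-free path goes down it cannot turn, because the unique parent of
  \<open>z\<close> is \<open>x\<close>, already visited. Hence a path to a different vertex that is
  no deeper must start with a step up.\<close>

lemma down_path_depth:
  assumes "distinct (x # z # q)" "successively TE (x # z # q)" "P x z"
  shows "d x < d (last (z # q))"
  using assms
proof (induction q arbitrary: x z)
  case Nil
  then show ?case
    by (simp add: P_depth)
next
  case (Cons w q)
  then have "P z w"
    by (auto simp: TE_def dest: P_unique)
  with Cons.IH[of z w] Cons.prems have "d z < d (last (w # q))"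
    by auto
  with P_depth[OF Cons.prems(3)] show ?case
    by simp
qed

lemma tree_path_step_up:
  assumes "tree_path x y p" "x \<noteq> y" "d y \<le> d x"
  shows "\<exists>z q. p = x # q \<and> P z x \<and> tree_path z y q"
proof -
  from assms(1,2) obtain z q where p: "p = x # z # q"
    unfolding tree_path_def by (metis hd_Cons_tl last_ConsL list.exhaust list.sel(1))
  with assms(1) have "TE x z" "d (last (z # q)) = d y"
    by (auto simp: tree_path_def)
  moreover have "\<not> P x z"
    using down_path_depth[of x z q] assms(1,3) p by (auto simp: tree_path_def)
  ultimately have "P z x"
    by (auto simp: TE_def)
  with p assms(1) show ?thesis
    by (auto simp: tree_path_def)
qed

lemma tree_path_refl: "tree_path x x p \<longleftrightarrow> p = [x]"
proof
  assume "tree_path x x p"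
  then show "p = [x]"
    unfolding tree_path_def
    by (metis distinct.simps(2) hd_Cons_tl last_ConsR last_in_set)
qed (auto simp: tree_path_def)

text \<open>Induction on the sum of the depths: at the end that is at least as deep, the step to the
  parent is forced. Reversing paths exchanges the two ends.\<close>

lemma ex1_tree_path:
  assumes "x \<in> TV" "y \<in> TV"
  shows "\<exists>!p. tree_path x y p"
  using assms
proof (induction "d x + d y" arbitrary: x y rule: less_induct)
  case less
  have up: "\<exists>!p. tree_path u w p"
    if IH: "\<And>a. P a u \<Longrightarrow> \<exists>!p. tree_path a w p"
      and uw: "u \<in> TV" "w \<in> TV" "u \<noteq> w" "d w \<le> d u" for u w
  proof -
    have "d u > 0"
      using uw root_unique[of u w] by (cases "d u") auto
    then obtain a where a: "P a u"
      using P_ex uw by blast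
    from IH[OF a] obtain q where q: "tree_path a w q"
      and q_unique: "\<And>q'. tree_path a w q' \<Longrightarrow> q' = q"
      by blast
    \<comment> \<open>Otherwise the tail of \<open>q\<close> from \<open>u\<close> on would itself
      step up to \<open>a\<close>, so the distinct list \<open>q\<close> would contain
      \<open>a\<close> twice.\<close>
    have "u \<notin> set q"
    proof
      assume "u \<in> set q"
      then obtain q1 q2 where q12: "q = q1 @ u # q2"
        by (meson split_list)
      have "a \<noteq> u"
        using P_depth[OF a] by auto
      with q q12 have q1: "q1 \<noteq> []" "hd q1 = a"
        by (auto simp: tree_path_def hd_append split: if_splits)
      have "tree_path u w (u # q2)"
        using q q12 by (auto simp: tree_path_def successively_append_iff)
      from tree_path_step_up[OF this uw(3,4)] obtain z where z: "P z u" "tree_path z w q2"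
        by auto
      then have "z = a"
        using a P_unique by blast
      then have "a \<in> set q2"
        using z unfolding tree_path_def by (metis hd_in_set)
      moreover have "a \<in> set q1"
        using q1 by (metis hd_in_set)
      ultimately show False
        using q q12 by (auto simp: tree_path_def)
    qed
    with q a have "tree_path u w (u # q)"
      by (auto simp: tree_path_def successively_Cons TE_def)
    moreover have "p = u # q" if "tree_path u w p" for p
      using tree_path_step_up[OF that uw(3,4)] q_unique P_unique[OF a] by blast
    ultimately show ?thesis
      by blast
  qed
  consider "x = y" | "x \<noteq> y" "d y \<le> d x" | "x \<noteq> y" "d x \<le> d y"
    by linarith
  then show ?case
  proof cases
    case 1
    then show ?thesis
      by (intro ex1I[of _ "[x]"]) (simp_all add: tree_path_refl)
  next
    case 2
    have "\<exists>!p. tree_path a y p" if "P a x" for a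
      using less.hyps[of a y] P_depth[OF that] P_in[OF that] less.prems by auto
    then show ?thesis
      using up[of x y] 2 less.prems by blast
  next
    case 3
    have "\<exists>!p. tree_path a x p" if "P a y" for a
      using less.hyps[of a x] P_depth[OF that] P_in[OF that] less.prems by auto
    then have "\<exists>!p. tree_path y x p"
      using up[of y x] 3 less.prems by blast
    then obtain p where p: "tree_path y x p" and p_unique: "\<And>q. tree_path y x q \<Longrightarrow> q = p"
      by blast
    show ?thesis
    proof (intro ex1I)
      show "tree_path x y (rev p)"
        using p by (rule tree_path_rev)
      show "q = rev p" if "tree_path x y q" for q
        using p_unique[OF tree_path_rev[OF that]] by auto
    qed
  qed
qed

lemma is_tree: "is_tree TV TE"
  unfolding is_tree_def is_graph_def
proof (intro conjI ballI allI impI)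
  fix x y assume "x \<in> TV" "y \<in> TV"
  then show "\<exists>!p. p \<noteq> [] \<and> hd p = x \<and> last p = y \<and> distinct p \<and> walk TE p"
    using ex1_tree_path[of x y] by (simp add: tree_path_def walk_eq_successively)
qed (use P_in P_depth nonempty in \<open>fastforce simp: TE_def\<close>)+

end


section \<open>Tree-decompositions from nested components\<close>

text \<open>The recursion in abstract form: the children of a node \<open>D\<close> are the
  components of \<open>D - B D\<close>. The predicate \<open>good\<close> is the invariant under
  which bags exist; the finite level sets of \<open>f\<close> ensure that every vertex is
  reached.\<close>

locale nested_bags =
  fixes V :: "'a set" and E :: "'a \<Rightarrow> 'a \<Rightarrow> bool"
    and B :: "'a set \<Rightarrow> 'a set" and good :: "'a set \<Rightarrow> bool" and f :: "'a \<Rightarrow> nat"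
  assumes graph: "is_graph V E"
    and good_V: "good V"
    and good_subset: "good D \<Longrightarrow> D \<subseteq> V"
    and good_comps: "good D \<Longrightarrow> C \<in> comps E (D - B D) \<Longrightarrow> good C"
    and bd_subset_B: "good D \<Longrightarrow> bd E D \<subseteq> B D"
    and B_subset: "good D \<Longrightarrow> B D \<subseteq> D \<union> bd E D"
    and B_minimal: "good D \<Longrightarrow> D \<noteq> {} \<Longrightarrow> \<exists>v\<in>D \<inter> B D. \<forall>w\<in>D. f v \<le> f w"
    and finite_level: "connected_in E C \<Longrightarrow> C \<subseteq> V \<Longrightarrow> finite {w\<in>C. f w \<le> n}"
begin

lemma E_sym: "E u v \<Longrightarrow> E v u"
  using graph by (auto simp: is_graph_def)

inductive node :: "nat \<Rightarrow> 'a set \<Rightarrow> bool" where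
  root: "node 0 V"
| child: "node n D \<Longrightarrow> C \<in> comps E (D - B D) \<Longrightarrow> node (Suc n) C"

definition TV :: "'a set set" where
  "TV = {D. \<exists>n. node n D}"

lemma node_good: "node n D \<Longrightarrow> good D"
  by (induction rule: node.induct) (auto intro: good_V good_comps)

lemma node_0_iff: "node 0 D \<longleftrightarrow> D = V"
  by (auto intro: root elim: node.cases)

lemma node_SucE:
  assumes "node (Suc n) C"
  obtains D where "node n D" "C \<in> comps E (D - B D)"
  using assms by (auto elim: node.cases)

lemma node_level_unique:
  "node n D \<Longrightarrow> node n D' \<Longrightarrow> v \<in> D \<Longrightarrow> v \<in> D' \<Longrightarrow> D = D'"
proof (induction n arbitrary: D D')
  case 0
  then show ?case
    by (simp add: node_0_iff)
next
  case (Suc n)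
  from Suc.prems(1) obtain A where A: "node n A" "D \<in> comps E (A - B A)"
    by (rule node_SucE)
  from Suc.prems(2) obtain A' where A': "node n A'" "D' \<in> comps E (A' - B A')"
    by (rule node_SucE)
  have "A = A'"
    using Suc.IH[OF A(1) A'(1)] Suc.prems comps_subset[OF A(2)] comps_subset[OF A'(2)] by blast
  then show ?case
    using comps_unique[of E, OF E_sym] A(2) A'(2) Suc.prems by blast
qed

lemma node_ancestor:
  "node n D \<Longrightarrow> m < n \<Longrightarrow> \<exists>A. node m A \<and> D \<subseteq> A - B A"
proof (induction rule: node.induct)
  case (child n D C)
  then show ?case
    using comps_subset[OF child.hyps(2)] by (cases "m = n") (blast, fastforce)
qed simp

text \<open>A vertex of \<open>T\<close> in its own bag is removed from everything below
  \<open>T\<close>. A deeper \<open>T'\<close> containing \<open>u\<close> would descend from a node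
  of level \<open>n\<close> containing \<open>u\<close>, and that node is \<open>T\<close>.\<close>

lemma node_depth_le:
  assumes "node n T" "node m T'" "u \<in> T" "u \<in> B T" "u \<in> T'"
  shows "m \<le> n"
proof (rule ccontr)
  assume "\<not> m \<le> n"
  then obtain A where "node n A" "T' \<subseteq> A - B A"
    using node_ancestor[OF assms(2), of n] by auto
  moreover from this have "A = T"
    using node_level_unique[of n A T u] assms by auto
  ultimately show False
    using assms by auto
qed

lemma node_depth_unique:
  assumes "node n D" "node m D"
  shows "n = m"
proof (cases "D = {}")
  \<comment> \<open>Components are nonempty, so the empty set can only occur as the root.\<close>
  case True
  have "k = 0" if "node k D" for k
    using that True comps_nonempty by (cases k) (auto elim!: node_SucE)
  then show ?thesis
    using assms by auto
next
  case False
  then obtain v where "v \<in> D" "v \<in> B D"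
    using B_minimal node_good[OF assms(1)] by blast
  then show ?thesis
    using node_depth_le[OF assms, of v] node_depth_le[OF assms(2,1), of v] by auto
qed

definition depth :: "'a set \<Rightarrow> nat" where
  "depth D = (THE n. node n D)"

lemma depth_eq: "node n D \<Longrightarrow> depth D = n"
  unfolding depth_def using node_depth_unique by blast

definition P :: "'a set \<Rightarrow> 'a set \<Rightarrow> bool" where
  "P D C \<longleftrightarrow> D \<in> TV \<and> C \<in> comps E (D - B D)"

lemma P_node: "P D C \<Longrightarrow> \<exists>n. node n D \<and> node (Suc n) C"
  unfolding P_def TV_def by (auto intro: node.child)

sublocale parent_tree TV P depth
proof
  fix x y assume "P x y"
  then obtain n where n: "node n x" "node (Suc n) y"
    using P_node by blast
  then show "x \<in> TV \<and> y \<in> TV"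
    by (auto simp: TV_def)
  from n show "depth y = Suc (depth x)"
    by (simp add: depth_eq)
  fix x' assume P': "P x' y"
  then obtain n' where n': "node n' x'" "node (Suc n') y"
    using P_node by blast
  then have "n' = n"
    using n(2) node_depth_unique by blast
  moreover obtain v where "v \<in> y"
    using \<open>P x y\<close> comps_nonempty[of y E] by (auto simp: P_def)
  moreover from this have "v \<in> x" "v \<in> x'"
    using \<open>P x y\<close> P' comps_subset by (fastforce simp: P_def)+
  ultimately show "x = x'"
    using n n' node_level_unique by blast
next
  fix y assume "y \<in> TV" "depth y > 0"
  then obtain k where "node k y"
    by (auto simp: TV_def)
  with \<open>depth y > 0\<close> obtain n where "node (Suc n) y"
    using depth_eq by (cases k) fastforce+
  then show "\<exists>x. P x y"
    by (rule node_SucE) (auto simp: P_def TV_def)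
next
  fix x y assume "x \<in> TV" "y \<in> TV" "depth x = 0" "depth y = 0"
  then show "x = y"
    by (auto simp: TV_def depth_eq node_0_iff)
next
  show "TV \<noteq> {}"
    using root by (auto simp: TV_def)
qed

text \<open>The minimum of \<^term>\<open>f\<close> on a component enters its bag, so that the level set
  \<^term>\<open>{w\<in>D. f w \<le> f v}\<close> shrinks strictly from \<^term>\<open>D\<close> to its child containing \<^term>\<open>v\<close>.\<close>

lemma home_exists_connected:
  assumes "node n D" "v \<in> D" "connected_in E D"
  shows "\<exists>m T. node m T \<and> v \<in> T \<and> v \<in> B T"
  using assms
proof (induction "card {w\<in>D. f w \<le> f v}" arbitrary: n D rule: less_induct)
  case less
  show ?case
  proof (cases "v \<in> B D")
    case True
    then show ?thesis
      using less.prems by blast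
  next
    case False
    with less.prems obtain C where C: "C \<in> comps E (D - B D)" "v \<in> C"
      using comps_cover[of v "D - B D" E] by auto
    have good: "good D"
      using less.prems node_good by blast
    then obtain u where u: "u \<in> D" "u \<in> B D" "\<And>w. w \<in> D \<Longrightarrow> f u \<le> f w"
      using B_minimal less.prems by blast
    have "{w\<in>C. f w \<le> f v} \<subset> {w\<in>D. f w \<le> f v}"
      using comps_subset[OF C(1)] u less.prems(2) by blast
    then have "card {w\<in>C. f w \<le> f v} < card {w\<in>D. f w \<le> f v}"
      using finite_level[OF less.prems(3) good_subset[OF good]] by (rule psubset_card_mono[rotated])
    then show ?thesis
      using less.hyps node.child[OF less.prems(1) C(1)] C(2)
        comps_connected[of E, OF E_sym C(1)] by blast
  qed
qed

text \<open>Such a \<open>T\<close> serves as the home of \<open>v\<close>. The root may be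
  disconnected, where level sets can be infinite; one step down all nodes are connected.\<close>

lemma home_exists:
  assumes "v \<in> V"
  shows "\<exists>m T. node m T \<and> v \<in> T \<and> v \<in> B T"
proof (cases "v \<in> B V")
  case True
  then show ?thesis
    using root assms by blast
next
  case False
  with assms obtain C where "C \<in> comps E (V - B V)" "v \<in> C"
    using comps_cover[of v "V - B V" E] by auto
  then show ?thesis
    using home_exists_connected node.child[OF root] comps_connected[of E, OF E_sym] by blast
qed

text \<open>If \<open>v\<close> lies in \<open>D\<close> and in its bag, then \<open>D\<close> is
  the home \<open>T\<close>. Otherwise \<open>v\<close> is a neighbour of \<open>D\<close>, so it
  lies in the bag of the parent of \<open>D\<close>, and the climb continues there.\<close>

lemma climb:
  assumes "node m T" "v \<in> T" "v \<in> B T"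
  shows "node n D \<Longrightarrow> v \<in> B D \<Longrightarrow> (restr TE {x\<in>TV. v \<in> B x})\<^sup>*\<^sup>* D T"
proof (induction n arbitrary: D)
  case 0
  then have D: "D = V"
    by (simp add: node_0_iff)
  then have "v \<in> D"
    using B_subset[OF good_V] 0 graph by (auto simp: bd_def is_graph_def)
  then have "n = 0" if "node n T" for n
    using node_depth_le[OF 0(1) that] 0 assms by auto
  then have "T = D"
    using assms(1) D node_0_iff by auto
  then show ?case
    by simp
next
  case (Suc n)
  show ?case
  proof (cases "v \<in> D")
    case True
    then have "m = Suc n"
      using node_depth_le[OF Suc.prems(1) assms(1), of v]
        node_depth_le[OF assms(1) Suc.prems(1), of v] assms Suc.prems by auto
    then have "D = T"
      using node_level_unique[of m D T v] Suc.prems assms True by auto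
    then show ?thesis
      by simp
  next
    case False
    obtain A where A: "node n A" "D \<in> comps E (A - B A)"
      using Suc.prems(1) by (rule node_SucE)
    have "v \<in> bd E D"
      using False Suc.prems B_subset node_good by blast
    then have "v \<notin> A - B A" and "v \<in> A \<union> bd E A"
      using comps_bd[OF A(2)] comps_subset[OF A(2)] by (auto simp: bd_def)
    then have "v \<in> B A"
      using bd_subset_B node_good[OF A(1)] by blast
    moreover from this have "restr TE {x\<in>TV. v \<in> B x} D A"
      using A Suc.prems by (auto simp: restr_def TE_def P_def TV_def)
    ultimately show ?thesis
      using Suc.IH[OF A(1)] by (simp add: converse_rtranclp_into_rtranclp)
  qed
qed

text \<open>The deeper of the two homes holds both ends: \<open>u\<close> is either a neighbour of
  \<open>T'\<close> or an element of it, and then the homes coincide.\<close>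

lemma edge_in_home:
  assumes "E u v" "node n T" "u \<in> T" "u \<in> B T" "node m T'" "v \<in> T'" "v \<in> B T'" "n \<le> m"
  shows "u \<in> B T'"
proof (cases "u \<in> T'")
  case True
  then have "m = n"
    using node_depth_le[OF assms(2,5)] assms by auto
  then show ?thesis
    using node_level_unique[of n T T' u] assms True by auto
next
  case False
  then have "u \<in> bd E T'"
    using assms E_sym by (auto simp: bd_def)
  then show ?thesis
    using bd_subset_B node_good assms by blast
qed

lemma tree_decomposition: "tree_decomposition V E TV TE B"
  unfolding tree_decomposition_def
proof (intro conjI ballI allI impI)
  show "is_tree TV TE"
    by (rule is_tree)
next
  fix x assume "x \<in> TV"
  then have "good x"
    using node_good by (auto simp: TV_def)
  then show "B x \<subseteq> V"
    using B_subset good_subset graph by (fastforce simp: bd_def is_graph_def)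
next
  fix u v assume uv: "E u v"
  then have "u \<in> V" "v \<in> V"
    using graph by (auto simp: is_graph_def)
  then obtain n T m T' where T: "node n T" "u \<in> T" "u \<in> B T" "node m T'" "v \<in> T'" "v \<in> B T'"
    using home_exists by meson
  then show "\<exists>x\<in>TV. u \<in> B x \<and> v \<in> B x"
    using edge_in_home[OF uv, of n T m T'] edge_in_home[OF E_sym[OF uv], of m T' n T]
    unfolding TV_def by (cases "n \<le> m") auto
next
  fix v assume "v \<in> V"
  then obtain m T where T: "node m T" "v \<in> T" "v \<in> B T"
    using home_exists by blast
  then show "{x\<in>TV. v \<in> B x} \<noteq> {}"
    by (auto simp: TV_def)
  have to_T: "(restr TE {x\<in>TV. v \<in> B x})\<^sup>*\<^sup>* D T" if "D \<in> {x\<in>TV. v \<in> B x}" for D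
    using that climb[OF T] by (auto simp: TV_def)
  have "(restr TE {x\<in>TV. v \<in> B x})\<^sup>*\<^sup>* T D" if "D \<in> {x\<in>TV. v \<in> B x}" for D
    by (rule restr_sym[of TE, OF TE_sym to_T[OF that]])
  with to_T show "connected_in TE {x\<in>TV. v \<in> B x}"
    unfolding connected_in_iff by (meson rtranclp_trans)
qed

end


section \<open>Balls and spheres\<close>

text \<open>\<open>ob E v i\<close> is the open ball of vertices at distance less than \<open>i\<close> from \<open>v\<close>; with this
  indexing linear growth reads \<open>|ob E v i| \<le> c i\<close> for all \<open>i\<close>, including \<open>0\<close>.\<close>

fun ob :: "('a \<Rightarrow> 'a \<Rightarrow> bool) \<Rightarrow> 'a \<Rightarrow> nat \<Rightarrow> 'a set" where
  "ob E v 0 = {}"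
| "ob E v (Suc i) = insert v (ob E v i \<union> {w. \<exists>u\<in>ob E v i. E u w})"

text \<open>The vertices at distance exactly \<open>i\<close>, since the balls are open.\<close>

definition sph :: "('a \<Rightarrow> 'a \<Rightarrow> bool) \<Rightarrow> 'a \<Rightarrow> nat \<Rightarrow> 'a set" where
  "sph E v i = ob E v (Suc i) - ob E v i"

lemma ob_mono: "i \<le> j \<Longrightarrow> ob E v i \<subseteq> ob E v j"
  by (rule lift_Suc_mono_le) auto

text \<open>Distance at most \<open>i\<close> followed by distance less than \<open>j\<close>; hence
  \<open>Suc\<close> in one premise only.\<close>

lemma ob_trans:
  assumes "x \<in> ob E v (Suc i)" "y \<in> ob E x j"
  shows "y \<in> ob E v (i + j)"
  using assms(2)
proof (induction j arbitrary: y)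
  case (Suc j)
  from Suc.prems consider "y = x" | "y \<in> ob E x j" | u where "u \<in> ob E x j" "E u y"
    by auto
  then show ?case
  proof cases
    case 1
    then show ?thesis
      using assms(1) ob_mono[of "Suc i" "i + Suc j" E v] by auto
  qed (use Suc.IH in auto)
qed simp

lemma ob_sym:
  assumes "\<And>u v. E u v \<Longrightarrow> E v u" "y \<in> ob E x j"
  shows "x \<in> ob E y j"
  using assms(2)
proof (induction j arbitrary: y)
  case (Suc j)
  from Suc.prems consider "y = x" | "y \<in> ob E x j" | u where "u \<in> ob E x j" "E u y"
    by auto
  then show ?case
  proof cases
    case 3
    then have "u \<in> ob E y (Suc 1)"
      using assms(1) by simp
    then show ?thesis
      using ob_trans[OF _ Suc.IH[OF 3(1)], of y 1] by simp
  qed (use Suc.IH in auto)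
qed simp

lemma ob_eventually: "(restr E S)\<^sup>*\<^sup>* v x \<Longrightarrow> \<exists>i. x \<in> ob E v i"
proof (induction rule: rtranclp_induct)
  case base
  have "v \<in> ob E v (Suc 0)"
    by simp
  then show ?case ..
next
  case (step y z)
  then obtain i where "y \<in> ob E v i"
    by auto
  with step.hyps have "z \<in> ob E v (Suc i)"
    by (auto simp: restr_def)
  then show ?case ..
qed

lemma ob_subset:
  assumes "is_graph V E" "v \<in> V"
  shows "ob E v i \<subseteq> V"
  using assms by (induction i) (auto simp: is_graph_def)

text \<open>A walk leaving the open ball would have to pass through the sphere.\<close>

lemma connected_subset_ob:
  assumes "connected_in E C" "C \<inter> sph E v i = {}" "x \<in> C" "x \<in> ob E v (Suc i)"
  shows "C \<subseteq> ob E v i"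
  using assms(1,3)
proof (rule connected_in_subset_closed)
  show "x \<in> ob E v i"
    using assms by (auto simp: sph_def)
next
  fix a b assume "a \<in> C" "b \<in> C" "E a b" "a \<in> ob E v i"
  then have "b \<in> ob E v (Suc i)"
    by auto
  with \<open>b \<in> C\<close> show "b \<in> ob E v i"
    using assms(2) by (auto simp: sph_def)
qed

lemma ob_subset_if_sph_empty:
  assumes "sph E v i = {}"
  shows "ob E v j \<subseteq> ob E v i"
proof (induction j)
  case (Suc j)
  have "ob E v (Suc i) \<subseteq> ob E v i"
    using assms by (auto simp: sph_def)
  with Suc show ?case
    by auto
qed simp

lemma ob_walk:
  "u \<in> ob E v (Suc r) \<Longrightarrow> \<exists>p. p \<noteq> [] \<and> hd p = v \<and> last p = u
      \<and> set p \<subseteq> ob E v (Suc r) \<and> walk E p \<and> length p \<le> r + 1"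
proof (induction r arbitrary: u)
  case 0
  then show ?case
    by (intro exI[of _ "[v]"]) (auto simp: walk_def)
next
  case (Suc r)
  have mono: "ob E v (Suc r) \<subseteq> ob E v (Suc (Suc r))"
    by (intro ob_mono) simp
  have "v \<in> ob E v (Suc r)"
    by simp
  with Suc.prems consider "u \<in> ob E v (Suc r)" | w where "w \<in> ob E v (Suc r)" "E w u"
    unfolding ob.simps(2)[of E v "Suc r"] by blast
  then show ?case
  proof cases
    case 1
    from Suc.IH[OF 1] obtain p where "p \<noteq> []" "hd p = v" "last p = u"
      "set p \<subseteq> ob E v (Suc r)" "walk E p" "length p \<le> r + 1"
      by blast
    with mono show ?thesis
      by (intro exI[of _ p]) (auto simp del: ob.simps)
  next
    case 2
    from Suc.IH[OF 2(1)] obtain p where p: "p \<noteq> []" "hd p = v" "last p = w"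
      "set p \<subseteq> ob E v (Suc r)" "walk E p" "length p \<le> r + 1"
      by blast
    have "set (p @ [u]) \<subseteq> ob E v (Suc (Suc r))"
      using subset_trans[OF p(4) mono] Suc.prems by (simp del: ob.simps)
    moreover have "walk E (p @ [u])"
      using p 2 by (simp add: walk_eq_successively successively_append_iff)
    ultimately show ?thesis
      using p by (intro exI[of _ "p @ [u]"]) (simp del: ob.simps)
  qed
qed

lemma walk_restr: "walk E p \<Longrightarrow> set p \<subseteq> S \<Longrightarrow> walk (restr E S) p"
  unfolding walk_def restr_def
  by (meson Suc_lessD nth_mem subsetD)

text \<open>The closed ball of radius \<open>r\<close> induces a subgraph of radius at most
  \<open>r\<close>, because the walks from \<open>ob_walk\<close> stay inside it.\<close>

lemma ecard_ob_le_growth: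
  assumes "is_graph V E" "v \<in> V"
  shows "ecard (ob E v (Suc r)) \<le> growth V E r"
proof -
  define S where "S = ob E v (Suc r)"
  have "S \<subseteq> V"
    unfolding S_def by (rule ob_subset[OF assms])
  have "subgraph S (restr E S) V E"
    using assms(1) \<open>S \<subseteq> V\<close> unfolding subgraph_def is_graph_def restr_def by blast
  moreover have "\<exists>p. p \<noteq> [] \<and> hd p = v \<and> last p = u \<and> set p \<subseteq> S
      \<and> walk (restr E S) p \<and> length p \<le> r + 1" if "u \<in> S" for u
  proof -
    from ob_walk[OF that[unfolded S_def], folded S_def] obtain p where p: "p \<noteq> []" "hd p = v"
      "last p = u" "set p \<subseteq> S" "walk E p" "length p \<le> r + 1"
      by (elim exE conjE)
    with walk_restr[OF p(5,4)] show ?thesis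
      by (intro exI[of _ p] conjI)
  qed
  then have "radius_le S (restr E S) r"
    unfolding radius_le_def by (intro bexI[of _ v]) (auto simp: S_def)
  ultimately have "ecard (fst (S, restr E S)) \<le> growth V E r"
    unfolding growth_def by (intro SUP_upper) auto
  then show ?thesis
    by (simp add: S_def)
qed

lemma connected_in_Un_bd:
  assumes sym: "\<And>u v. E u v \<Longrightarrow> E v u" and C: "connected_in E C" and A: "A \<subseteq> bd E C"
  shows "connected_in E (C \<union> A)"
proof (cases "C = {}")
  case True
  with A show ?thesis
    by (auto simp: bd_def connected_in_def)
next
  case False
  then obtain x where x: "x \<in> C"
    by auto
  have in_C: "(restr E (C \<union> A))\<^sup>*\<^sup>* x y" if "y \<in> C" for y
    using C x that restr_mono[of E C x y "C \<union> A"] by (auto simp: connected_in_iff)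
  have to: "(restr E (C \<union> A))\<^sup>*\<^sup>* x y" if "y \<in> C \<union> A" for y
  proof (cases "y \<in> C")
    case False
    with that A obtain u where u: "u \<in> C" "E u y"
      by (auto simp: bd_def)
    then have "restr E (C \<union> A) u y"
      using that by (simp add: restr_def)
    with in_C[OF u(1)] show ?thesis
      by (rule rtranclp.rtrancl_into_rtrancl)
  qed (rule in_C)
  have "(restr E (C \<union> A))\<^sup>*\<^sup>* y x" if "y \<in> C \<union> A" for y
    by (rule restr_sym[of E, OF sym to[OF that]])
  then show ?thesis
    unfolding connected_in_iff using to by (auto intro: rtranclp_trans[of _ _ x])
qed


section \<open>Balanced separators\<close>

locale linear_balls =
  fixes V :: "'a set" and E :: "'a \<Rightarrow> 'a \<Rightarrow> bool" and c :: real
  assumes graph: "is_graph V E"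
    and c_nonneg: "c \<ge> 0"
    and finite_ob: "v \<in> V \<Longrightarrow> finite (ob E v i)"
    and card_ob: "v \<in> V \<Longrightarrow> card (ob E v i) \<le> c * i"
begin

lemma E_sym: "E u v \<Longrightarrow> E v u"
  using graph by (auto simp: is_graph_def)

lemma finite_sph: "v \<in> V \<Longrightarrow> finite (sph E v i)"
  unfolding sph_def by (intro finite_Diff finite_ob)

lemma sum_card_sph:
  assumes "v \<in> V"
  shows "(\<Sum>i<q. card (sph E v i)) = card (ob E v q)"
proof (induction q)
  case (Suc q)
  have "ob E v q \<subseteq> ob E v (Suc q)"
    by (intro ob_mono) simp
  then have "card (sph E v q) = card (ob E v (Suc q)) - card (ob E v q)"
    and "card (ob E v q) \<le> card (ob E v (Suc q))"
    unfolding sph_def using finite_ob[OF assms] by (simp_all only: card_Diff_subset card_mono)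
  with Suc show ?case
    by simp
qed simp

text \<open>Averaging: the spheres with radius in \<open>{p..<q}\<close> are disjoint, number at
  least \<open>q / 2\<close>, and share at most \<open>c * q\<close> vertices.\<close>

lemma small_sphere:
  assumes "v \<in> V" "2 * p \<le> q" "p < q"
  shows "\<exists>i\<in>{p..<q}. real (card (sph E v i)) \<le> 2 * c"
proof (rule ccontr)
  assume "\<not> ?thesis"
  then have "2 * c < real (card (sph E v i))" if "i \<in> {p..<q}" for i
    using that by (meson not_le)
  then have "(\<Sum>i\<in>{p..<q}. 2 * c) < (\<Sum>i\<in>{p..<q}. real (card (sph E v i)))"
    using assms by (intro sum_strict_mono) auto
  also have "\<dots> \<le> (\<Sum>i<q. real (card (sph E v i)))"
    by (intro sum_mono2) auto
  also have "\<dots> = card (ob E v q)"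
    using sum_card_sph[OF assms(1), of q] by (metis of_nat_sum)
  also have "\<dots> \<le> c * q"
    by (rule card_ob[OF assms(1)])
  finally have "c * (2 * (real q - real p)) < c * real q"
    using assms by (simp add: of_nat_diff algebra_simps)
  moreover have "real (2 * p) \<le> real q"
    using assms(2) by (rule of_nat_mono)
  then have "c * real q \<le> c * (2 * (real q - real p))"
    using c_nonneg by (intro mult_left_mono) simp_all
  ultimately show False
    by linarith
qed

text \<open>The open balls of radius \<open>(R - 1) div 4 + 1\<close> around a maximal packing \<open>U\<close> are disjoint
  parts of a ball of radius at most five times as large, and have size at least their radius.\<close>

lemma packing_cover:
  fixes v R
  defines "\<rho> \<equiv> (R - 1) div 4"
  assumes v: "v \<in> V" and R: "R > 0"
    and large: "\<And>u i. u \<in> ob E v R \<Longrightarrow> i < R \<Longrightarrow> sph E u i \<noteq> {}"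
  obtains U where "finite U" "U \<subseteq> ob E v R" "real (card U) \<le> 5 * c"
    "ob E v R \<subseteq> (\<Union>u\<in>U. ob E u (Suc (2 * \<rho>)))"
proof -
  define s where "s = Suc \<rho>"
  have ob_V: "ob E v i \<subseteq> V" for i
    using ob_subset[OF graph v] .
  have R_s: "R \<le> 4 * s" "s \<le> R"
    using R by (auto simp: s_def \<rho>_def)
  define F where "F = {U. U \<subseteq> ob E v R \<and> (\<forall>a\<in>U. \<forall>b\<in>U. a \<noteq> b \<longrightarrow> ob E a s \<inter> ob E b s = {})}"
  have "finite F"
    unfolding F_def using finite_ob[OF v, of R] by simp
  moreover have "{} \<in> F"
    by (simp add: F_def)
  ultimately obtain U where U: "U \<in> F" and U_max: "\<forall>U'\<in>F. U \<subseteq> U' \<longrightarrow> U = U'"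
    using finite_has_maximal[of F] by auto
  have U_sub: "U \<subseteq> ob E v R"
    using U by (simp add: F_def)
  have U_V: "U \<subseteq> V"
    using U_sub ob_V by blast
  have fin_U: "finite U"
    using U_sub finite_ob[OF v] by (rule finite_subset)
  have s_le: "s \<le> card (ob E u s)" if "u \<in> U" for u
  proof -
    have "u \<in> V"
      using that U_V by blast
    \<comment> \<open>As \<open>s \<le> R\<close>, the assumption \<open>large\<close> covers all
      \<open>s\<close> spheres that make up the ball.\<close>
    have "1 \<le> card (sph E u i)" if "i < s" for i
      using large[of u i] that R_s U_sub \<open>u \<in> U\<close> finite_sph[OF \<open>u \<in> V\<close>, of i]
      by (simp add: Suc_le_eq card_gt_0_iff subset_iff)
    then have "(\<Sum>i<s. 1) \<le> (\<Sum>i<s. card (sph E u i))"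
      by (intro sum_mono) auto
    then show ?thesis
      using sum_card_sph[OF \<open>u \<in> V\<close>, of s] by simp
  qed
  have "(\<Union>u\<in>U. ob E u s) \<subseteq> ob E v (R - 1 + s)"
    using U_sub R ob_trans[of _ E v "R - 1"] by fastforce
  then have "card (\<Union>u\<in>U. ob E u s) \<le> card (ob E v (R - 1 + s))"
    by (intro card_mono finite_ob v)
  moreover have "card (\<Union>u\<in>U. ob E u s) = (\<Sum>u\<in>U. card (ob E u s))"
    using U U_V fin_U by (intro card_UN_disjoint) (auto simp: F_def finite_ob)
  moreover have "card U * s \<le> (\<Sum>u\<in>U. card (ob E u s))"
    using sum_bounded_below[of U s] s_le by auto
  ultimately have "card U * s \<le> card (ob E v (R - 1 + s))"
    by linarith
  then have "real (card U) * s \<le> card (ob E v (R - 1 + s))"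
    by (metis of_nat_le_iff of_nat_mult)
  also have "\<dots> \<le> c * real (R - 1 + s)"
    by (rule card_ob[OF v])
  \<comment> \<open>From \<open>R \<le> 4 * s\<close>; this is the origin of the factor 5.\<close>
  also have "\<dots> \<le> c * (5 * s)"
    using c_nonneg R_s by (intro mult_left_mono) auto
  finally have "real (card U) * s \<le> (5 * c) * s"
    by (simp add: algebra_simps)
  then have "real (card U) \<le> 5 * c"
    by (rule mult_right_le_imp_le) (simp add: s_def)
  moreover have "ob E v R \<subseteq> (\<Union>u\<in>U. ob E u (Suc (2 * \<rho>)))"
  proof
    fix x assume x: "x \<in> ob E v R"
    \<comment> \<open>By maximality: otherwise \<open>x\<close> could be added to the
      packing.\<close>
    have "\<exists>u\<in>U. ob E x s \<inter> ob E u s \<noteq> {}"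
    proof (rule ccontr)
      assume *: "\<not> ?thesis"
      then have "insert x U \<in> F"
        using U x by (auto simp: F_def)
      then have "x \<in> U"
        using U_max by blast
      then show False
        using * by (auto simp: s_def)
    qed
    then obtain u y where u: "u \<in> U" and y: "y \<in> ob E x s" "y \<in> ob E u (Suc \<rho>)"
      by (auto simp: s_def)
    \<comment> \<open>The common vertex \<open>y\<close> has distance at most \<open>\<rho>\<close>
      from both centres.\<close>
    then have "x \<in> ob E u (\<rho> + s)"
      using ob_trans ob_sym[of E, OF E_sym] by metis
    then show "x \<in> (\<Union>u\<in>U. ob E u (Suc (2 * \<rho>)))"
      using u by (auto simp: s_def mult_2)
  qed
  ultimately show ?thesis
    using that fin_U U_sub by blast
qed

text \<open>Otherwise every small set \<open>X\<close> misses a big connected set, and two big sets meet. Take a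
  smallest ball \<open>ob E v R\<close> containing a big set \<open>C\<close>, cover it by \<open>5 c\<close> balls of about half its
  radius with boundary spheres of size at most \<open>2 c\<close>, and let \<open>X\<close> be the union of these spheres.
  A big set avoiding \<open>X\<close> meets \<open>C\<close>, hence lies inside one of the smaller balls.\<close>

lemma balanced_separator:
  assumes c: "c \<ge> 1" and W: "finite W"
  shows "\<exists>X. finite X \<and> real (card X) \<le> 10 * c\<^sup>2 \<and>
    (\<forall>C \<subseteq> V. connected_in E C \<longrightarrow> C \<inter> X = {} \<longrightarrow> 2 * card (C \<inter> W) \<le> card W)"
proof (rule ccontr)
  define big where "big C \<longleftrightarrow> C \<subseteq> V \<and> connected_in E C \<and> card W < 2 * card (C \<inter> W)" for C
  assume "\<not> ?thesis"
  then have big_ex: "\<exists>C. big C \<and> C \<inter> X = {}" if "finite X" "real (card X) \<le> 10 * c\<^sup>2" for X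
    unfolding big_def using that by (meson not_le)
  have c2: "c \<le> c\<^sup>2"
    using c by (simp add: power2_eq_square)
  have big_meet: "\<exists>x\<in>W. x \<in> C \<and> x \<in> C'" if "big C" "big C'" for C C'
  proof (rule ccontr)
    assume "\<not> ?thesis"
    then have "card (C \<inter> W) + card (C' \<inter> W) = card (C \<inter> W \<union> C' \<inter> W)"
      using W by (intro card_Un_disjoint[symmetric]) auto
    also have "\<dots> \<le> card W"
      using W by (intro card_mono) auto
    finally show False
      using that by (auto simp: big_def)
  qed
  define Q where "Q i \<longleftrightarrow> (\<exists>v\<in>V. \<exists>C. big C \<and> C \<subseteq> ob E v i)" for i
  \<comment> \<open>A big set \<open>C\<close> may be infinite and lie in no ball. Instead a small
    sphere enclosing \<open>C \<inter> W\<close> is deleted: a big set avoiding it meets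
    \<open>C\<close> in \<open>W\<close>, hence lies inside the ball.\<close>
  have "\<exists>i. Q i"
  proof -
    obtain C where C: "big C"
      using big_ex[of "{}"] by auto
    then obtain v where v: "v \<in> C"
      using big_meet by blast
    then have vV: "v \<in> V"
      using C by (auto simp: big_def)
    have "\<exists>i. x \<in> ob E v i" if "x \<in> C" for x
      using C v that ob_eventually[of E C v x] by (auto simp: big_def connected_in_iff)
    then obtain g where g: "\<And>x. x \<in> C \<Longrightarrow> x \<in> ob E v (g x)"
      by metis
    \<comment> \<open>The sum is merely a convenient upper bound for all \<open>g x\<close> with
      \<open>x\<close> in \<open>C \<inter> W\<close>.\<close>
    define i0 where "i0 = sum g (C \<inter> W)"
    obtain i where i: "i0 \<le> i" "real (card (sph E v i)) \<le> 2 * c"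
      using small_sphere[OF vV, of i0 "Suc (2 * i0)"] by auto
    then have "real (card (sph E v i)) \<le> 10 * c\<^sup>2"
      using c c2 by linarith
    then obtain C' where C': "big C'" "C' \<inter> sph E v i = {}"
      using big_ex finite_sph[OF vV] by blast
    then obtain x where x: "x \<in> C \<inter> W" "x \<in> C'"
      using big_meet[OF C] by blast
    then have "g x \<le> i0"
      unfolding i0_def using W by (intro member_le_sum) auto
    then have "x \<in> ob E v (Suc i)"
      using g[of x] x i ob_mono[of "g x" "Suc i" E v] by auto
    then have "C' \<subseteq> ob E v i"
      using connected_subset_ob[OF _ C'(2) x(2)] C' by (auto simp: big_def)
    then show ?thesis
      unfolding Q_def using vV C' by blast
  qed
  define R where "R = (LEAST i. Q i)"
  have "Q R"
    unfolding R_def using \<open>\<exists>i. Q i\<close> by (rule LeastI_ex)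
  have min_R: "\<not> Q i" if "i < R" for i
    using that not_less_Least unfolding R_def by blast
  from \<open>Q R\<close> obtain v C where v: "v \<in> V" and C: "big C" "C \<subseteq> ob E v R"
    by (auto simp: Q_def)
  have R: "R > 0"
    using C big_meet[of C C] by (cases R) auto
  have ob_V: "ob E v R \<subseteq> V"
    using ob_subset[OF graph v] .
  \<comment> \<open>An empty sphere means that the ball has stopped growing, so
    \<open>ob E u i\<close> would contain \<open>C\<close> although \<open>i < R\<close>.\<close>
  have "sph E u i \<noteq> {}" if u: "u \<in> ob E v R" and i: "i < R" for u i
  proof
    assume empty: "sph E u i = {}"
    have "v \<in> ob E u (Suc (R - 1))"
      using ob_sym[of E, OF E_sym u] R by simp
    then have "C \<subseteq> ob E u (R - 1 + R)"
      using C ob_trans by fast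
    also have "\<dots> \<subseteq> ob E u i"
      by (rule ob_subset_if_sph_empty[OF empty])
    finally have "Q i"
      using C u ob_V by (auto simp: Q_def)
    then show False
      using min_R i by blast
  qed
  then obtain U where U: "finite U" "U \<subseteq> ob E v R" "real (card U) \<le> 5 * c"
    "ob E v R \<subseteq> (\<Union>u\<in>U. ob E u (Suc (2 * ((R - 1) div 4))))"
    using packing_cover[OF v R] by blast
  \<comment> \<open>The lower end keeps the balls large enough to cover \<open>ob E v R\<close>; the
    upper end makes a big set inside one of them contradict the minimality of \<open>R\<close>. The
    range is long enough because \<open>4 * ((R - 1) div 4) \<le> R\<close>.\<close>
  have "\<exists>i\<in>{2 * ((R - 1) div 4)..<R}. real (card (sph E u i)) \<le> 2 * c" if "u \<in> U" for u
    using that U(2) ob_V R by (intro small_sphere) auto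
  then obtain j where j: "\<And>u. u \<in> U \<Longrightarrow> j u \<in> {2 * ((R - 1) div 4)..<R}"
    "\<And>u. u \<in> U \<Longrightarrow> real (card (sph E u (j u))) \<le> 2 * c"
    by metis
  define X where "X = (\<Union>u\<in>U. sph E u (j u))"
  have "finite X"
    unfolding X_def using U finite_sph ob_V by blast
  moreover have "real (card X) \<le> 10 * c\<^sup>2"
  proof -
    have "card X \<le> (\<Sum>u\<in>U. card (sph E u (j u)))"
      unfolding X_def using U(1) by (rule card_UN_le)
    then have "real (card X) \<le> (\<Sum>u\<in>U. real (card (sph E u (j u))))"
      by (metis of_nat_le_iff of_nat_sum)
    also have "\<dots> \<le> real (card U) * (2 * c)"
      using j(2) by (rule sum_bounded_above)
    also have "\<dots> \<le> 5 * c * (2 * c)"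
      using U(3) c by (intro mult_right_mono) auto
    finally show ?thesis
      by (simp add: power2_eq_square)
  qed
  ultimately obtain C' where C': "big C'" "C' \<inter> X = {}"
    using big_ex by blast
  then obtain x where x: "x \<in> C" "x \<in> C'"
    using big_meet C(1) by blast
  then obtain u where u: "u \<in> U" "x \<in> ob E u (Suc (2 * ((R - 1) div 4)))"
    using C(2) U(4) by blast
  then have "x \<in> ob E u (Suc (j u))"
    using ob_mono[of "Suc (2 * ((R - 1) div 4))" "Suc (j u)" E u] j(1)[of u] by auto
  moreover have "C' \<inter> sph E u (j u) = {}"
    using C' u by (auto simp: X_def)
  ultimately have "C' \<subseteq> ob E u (j u)"
    using connected_subset_ob[of E C'] x C' by (auto simp: big_def)
  then have "Q (j u)"
    unfolding Q_def using C'(1) u(1) U(2) ob_V by blast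
  then show False
    using min_R j(1)[OF u(1)] by auto
qed

section \<open>Level function, bags and the resulting decomposition\<close>

text \<open>Take one plus the distance to a representative of the component; a level set of a
  connected set then lies in one finite ball.\<close>

lemma finite_level_function:
  obtains f :: "'a \<Rightarrow> nat"
  where "\<And>C n. connected_in E C \<Longrightarrow> C \<subseteq> V \<Longrightarrow> finite {w\<in>C. f w \<le> n}"
proof -
  define rep where "rep v = (SOME u. (restr E V)\<^sup>*\<^sup>* v u)" for v
  define f where "f w = (LEAST i. w \<in> ob E (rep w) i)" for w
  have rep: "(restr E V)\<^sup>*\<^sup>* v (rep v)" for v
    unfolding rep_def by (rule someI) (rule rtranclp.rtrancl_refl)
  have "finite {w\<in>C. f w \<le> n}" if C: "connected_in E C" "C \<subseteq> V" for C n
  proof (cases "C = {}")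
    case False
    then obtain v where v: "v \<in> C"
      by auto
    have conn: "(restr E V)\<^sup>*\<^sup>* v w" if "w \<in> C" for w
      using C v that restr_mono[of E C v w V] by (auto simp: connected_in_iff)
    \<comment> \<open>Both sides apply \<open>SOME\<close> to the same predicate, reachability from
      the component.\<close>
    have rep_eq: "rep w = rep v" if "w \<in> C" for w
    proof -
      have "(restr E V)\<^sup>*\<^sup>* w v"
        by (rule restr_sym[of E, OF E_sym conn[OF that]])
      then have "(restr E V)\<^sup>*\<^sup>* w u \<longleftrightarrow> (restr E V)\<^sup>*\<^sup>* v u" for u
        using conn[OF that] by (meson rtranclp_trans)
      then show ?thesis
        by (simp add: rep_def)
    qed
    have repV: "rep v \<in> V"
      using rep[of v] v C(2) by cases (auto simp: restr_def)
    have "w \<in> ob E (rep v) n" if "w \<in> C" "f w \<le> n" for w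
    proof -
      have "(restr E V)\<^sup>*\<^sup>* (rep w) w"
        by (rule restr_sym[of E, OF E_sym rep])
      then have "\<exists>i. w \<in> ob E (rep w) i"
        by (rule ob_eventually)
      then have "w \<in> ob E (rep w) (f w)"
        unfolding f_def by (rule LeastI_ex)
      then show ?thesis
        using rep_eq[OF that(1)] ob_mono[OF that(2), of E "rep v"] by auto
    qed
    then show ?thesis
      using finite_ob[OF repV] by (auto intro: finite_subset)
  qed simp
  then show ?thesis
    by (rule that)
qed

text \<open>The bag consists of \<open>W\<close>, of size at most \<open>2 * k + 1\<close>, and at
  most \<open>k\<close> separator vertices. A component below has at most \<open>k\<close>
  neighbours in \<open>W\<close> outside \<open>X\<close>, by balance, and at most \<open>k\<close>
  in \<open>X\<close>, which restores the bound \<open>2 * k\<close>.\<close>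

lemma bag_exists:
  fixes f :: "'a \<Rightarrow> nat"
  assumes c: "c \<ge> 1" and k: "k = nat \<lfloor>10 * c\<^sup>2\<rfloor>"
    and D: "D \<subseteq> V" "finite (bd E D)" "card (bd E D) \<le> 2 * k"
  shows "\<exists>B. bd E D \<subseteq> B \<and> B \<subseteq> D \<union> bd E D \<and> finite B \<and> card B \<le> 3 * k + 1
    \<and> (D \<noteq> {} \<longrightarrow> (\<exists>v\<in>D \<inter> B. \<forall>w\<in>D. f v \<le> f w))
    \<and> (\<forall>C\<in>comps E (D - B). finite (bd E C) \<and> card (bd E C) \<le> 2 * k)"
proof (cases "D = {}")
  case True
  then show ?thesis
    by (intro exI[of _ "{}"]) (auto simp: bd_def comps_def)
next
  case False
  then obtain v where v: "v \<in> D" "\<forall>w\<in>D. f v \<le> f w"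
    using ex_has_least_nat[of "\<lambda>x. x \<in> D" _ f] by blast
  define W where "W = insert v (bd E D)"
  have W: "finite W" "card W \<le> 2 * k + 1"
    using D card_insert_le_m1[of "2 * k + 1" "bd E D" v] by (auto simp: W_def)
  then obtain X where X: "finite X" "real (card X) \<le> 10 * c\<^sup>2"
    and sep: "\<And>C. C \<subseteq> V \<Longrightarrow> connected_in E C \<Longrightarrow> C \<inter> X = {} \<Longrightarrow> 2 * card (C \<inter> W) \<le> card W"
    using balanced_separator[OF c W(1)] by blast
  have card_X: "card X \<le> k"
    using X(2) unfolding k by (simp add: le_nat_floor)
  \<comment> \<open>Only \<open>X \<inter> D\<close> is added, so that the bag stays within
    \<open>D \<union> bd E D\<close>; components of \<open>D - B\<close> still avoid all of
    \<open>X\<close>.\<close>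
  define B where "B = W \<union> (X \<inter> D)"
  have B: "finite B" "card B \<le> 3 * k + 1"
  proof -
    show "finite B"
      using W X by (simp add: B_def)
    have "card B \<le> card W + card (X \<inter> D)"
      unfolding B_def by (rule card_Un_le)
    also have "card (X \<inter> D) \<le> card X"
      using X by (intro card_mono) auto
    finally show "card B \<le> 3 * k + 1"
      using W card_X by linarith
  qed
  have "finite (bd E C) \<and> card (bd E C) \<le> 2 * k" if C: "C \<in> comps E (D - B)" for C
  proof -
    have C_sub: "C \<subseteq> D - B"
      using C by (rule comps_subset)
    have bd_C: "bd E C \<subseteq> B"
      using comps_bd[OF C] C_sub by (fastforce simp: bd_def B_def W_def)
    text \<open>The bound must be applied to the component together with its neighbours outside \<open>X\<close>,
      since the component itself contains no vertex of \<open>W\<close>.\<close>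
    define C' where "C' = C \<union> (bd E C - X)"
    have "connected_in E C'"
      unfolding C'_def using comps_connected[of E, OF E_sym C]
      by (intro connected_in_Un_bd) (auto intro: E_sym)
    moreover have "C' \<inter> X = {}"
      using C_sub by (auto simp: C'_def B_def)
    moreover have "C' \<subseteq> V"
      using C_sub D(1) graph by (auto simp: C'_def bd_def is_graph_def)
    ultimately have "2 * card (C' \<inter> W) \<le> card W"
      using sep by blast
    then have "card (C' \<inter> W) \<le> k"
      using W by linarith
    moreover have "bd E C \<subseteq> (C' \<inter> W) \<union> X"
      using bd_C by (auto simp: C'_def B_def)
    then have "card (bd E C) \<le> card (C' \<inter> W \<union> X)"
      using W X by (intro card_mono) auto
    then have "card (bd E C) \<le> card (C' \<inter> W) + card X"
      using card_Un_le[of "C' \<inter> W" X] by linarith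
    ultimately show ?thesis
      using card_X bd_C B by (auto intro: finite_subset)
  qed
  moreover have "bd E D \<subseteq> B" "B \<subseteq> D \<union> bd E D" "v \<in> D \<inter> B"
    using v by (auto simp: B_def W_def)
  ultimately show ?thesis
    using B v by blast
qed

text \<open>The invariant \<open>good\<close> holds at the root because \<open>V\<close> has empty
  boundary, and \<open>bag_exists\<close> passes it on to the children.\<close>

lemma treewidth_le:
  assumes c: "c \<ge> 1"
  shows "treewidth V E \<le> enat (3 * nat \<lfloor>10 * c\<^sup>2\<rfloor>)"
proof -
  define k where "k = nat \<lfloor>10 * c\<^sup>2\<rfloor>"
  obtain f :: "'a \<Rightarrow> nat" where
    f: "\<And>C n. connected_in E C \<Longrightarrow> C \<subseteq> V \<Longrightarrow> finite {w\<in>C. f w \<le> n}"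
    using finite_level_function by blast
  define good where "good D \<longleftrightarrow> D \<subseteq> V \<and> finite (bd E D) \<and> card (bd E D) \<le> 2 * k" for D
  have "\<exists>B. bd E D \<subseteq> B \<and> B \<subseteq> D \<union> bd E D \<and> finite B \<and> card B \<le> 3 * k + 1
    \<and> (D \<noteq> {} \<longrightarrow> (\<exists>v\<in>D \<inter> B. \<forall>w\<in>D. f v \<le> f w))
    \<and> (\<forall>C\<in>comps E (D - B). finite (bd E C) \<and> card (bd E C) \<le> 2 * k)" if "good D" for D
    using that by (intro bag_exists[OF c k_def]) (auto simp: good_def)
  then obtain B where B: "\<And>D. good D \<Longrightarrow> bd E D \<subseteq> B D \<and> B D \<subseteq> D \<union> bd E D \<and> finite (B D)
    \<and> card (B D) \<le> 3 * k + 1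
    \<and> (D \<noteq> {} \<longrightarrow> (\<exists>v\<in>D \<inter> B D. \<forall>w\<in>D. f v \<le> f w))
    \<and> (\<forall>C\<in>comps E (D - B D). finite (bd E C) \<and> card (bd E C) \<le> 2 * k)"
    by metis
  interpret bags: nested_bags V E B good f
  proof
    have "bd E V = {}"
      using graph by (auto simp: bd_def is_graph_def)
    then show "good V"
      by (simp add: good_def)
    show "good C" if "good D" "C \<in> comps E (D - B D)" for C D
      using B[OF that(1)] that comps_subset[OF that(2)] by (auto simp: good_def)
    show "D \<subseteq> V" if "good D" for D
      using that by (simp add: good_def)
    fix D assume "good D"
    from B[OF this] show "bd E D \<subseteq> B D" "B D \<subseteq> D \<union> bd E D"
      and "D \<noteq> {} \<Longrightarrow> \<exists>v\<in>D \<inter> B D. \<forall>w\<in>D. f v \<le> f w"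
      by blast+
  qed (fact graph f)+
  have "finite (B D) \<and> card (B D) \<le> 3 * k + 1" if "D \<in> bags.TV" for D
    using that B[of D] bags.node_good[of _ D] unfolding bags.TV_def by blast
  then have "width_le bags.TV B (3 * k)"
    by (simp add: width_le_def)
  with bags.tree_decomposition show ?thesis
    unfolding treewidth_def k_def by (intro Inf_lower) blast
qed

end

theorem theorem1:
  fixes c :: real and V :: "'a set" and E :: "'a \<Rightarrow> 'a \<Rightarrow> bool"
  assumes "c \<ge> 1"
    and "is_graph V E"
    and "\<forall>r::nat. r \<ge> 1 \<longrightarrow> growth V E r \<le> enat (nat \<lfloor>c * real r\<rfloor>)"
  shows "treewidth V E \<le> enat (nat \<lfloor>49 * c^2 + 30 * c\<rfloor>)"
proof -
  have ob: "finite (ob E v i) \<and> real (card (ob E v i)) \<le> c * i" if v: "v \<in> V" for v i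
  proof -
    \<comment> \<open>The open ball of radius \<open>Suc r\<close> is the closed ball of radius
      \<open>r\<close>, and growth is bounded only for \<open>r \<ge> 1\<close>. The empty ball and
      the single vertex are checked directly, the latter by \<open>c \<ge> 1\<close>.\<close>
    consider "i = 0" | "i = Suc 0" | r where "r \<ge> 1" "i = Suc r"
      by (metis One_nat_def Suc_le_eq not0_implies_Suc zero_less_Suc)
    then show ?thesis
    proof cases
      case 3
      have "ecard (ob E v i) \<le> growth V E r"
        unfolding 3 by (rule ecard_ob_le_growth[OF assms(2) v])
      also have "\<dots> \<le> enat (nat \<lfloor>c * real r\<rfloor>)"
        using assms(3) 3 by blast
      finally have fin: "finite (ob E v i)" and "card (ob E v i) \<le> nat \<lfloor>c * real r\<rfloor>"
        by (auto simp: ecard_def split: if_splits)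
      then have "real (card (ob E v i)) \<le> c * r"
        using assms(1) by (simp add: le_nat_iff le_floor_iff)
      also have "\<dots> \<le> c * i"
        using 3 assms(1) by simp
      finally show ?thesis
        using fin by simp
    qed (use assms(1) in auto)
  qed
  interpret linear_balls V E c
    using assms ob by unfold_locales auto
  \<comment> \<open>The construction yields width at most \<open>30 * c\<^sup>2\<close>, which is
    below the stated bound.\<close>
  have "real (3 * nat \<lfloor>10 * c\<^sup>2\<rfloor>) \<le> 49 * c^2 + 30 * c"
  proof -
    have "real (nat \<lfloor>10 * c\<^sup>2\<rfloor>) \<le> 10 * c\<^sup>2"
      by simp
    moreover have "0 \<le> c\<^sup>2"
      by simp
    ultimately show ?thesis
      unfolding of_nat_mult of_nat_numeral using assms(1) by linarith
  qed
  then have "3 * nat \<lfloor>10 * c\<^sup>2\<rfloor> \<le> nat \<lfloor>49 * c^2 + 30 * c\<rfloor>"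
    by (rule le_nat_floor)
  with treewidth_le[OF assms(1)] show ?thesis
    by (meson enat_ord_simps(1) order_trans)
qed

end
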